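(* Let $A\in GL(n,\mathbb{R})$, $v\in\mathbb{R}^n$, and let $f_{A,v}(x)=Ax+v$ on $\mathbb{R}^n$. If $n\ge 2$ and $v\notin\operatorname{Im}(I-A)$, then $f_{A,v}$ is smoothly conjugate to one of the following normal forms: - if $\det A>0$: the map $(t,z)\mapsto(t+1,z)$ on $\mathbb{R}\times\mathbb{R}^{n-1}$; - if $\det A<0$: the map $(t,y,z')\mapsto(t+1,-y,z')$ on $\mathbb{R}\times\mathbb{R}\times\mathbb{R}^{n-2}$.
   Context: Two diffeomorphisms $F$ of $M$ and $G$ of $N$ are smoothly conjugate if there is a $C^\infty$ diffeomorphism $H:M\to N$ with $H\circ F\circ H^{-1}=G$. *)

theory Defs
  imports "HOL-Analysis.Analysis"
begin

text \<open>
  Being \<open>C\<^sup>k\<close> on the whole of a Euclidean space, by recursion on \<open>k\<close>. To keep the types fixed, the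
  derivative is taken one direction \<open>v\<close> at a time; in finite dimension the map
  \<open>x \<mapsto> Df(x)\<close> is \<open>C\<^sup>k\<close> iff \<open>x \<mapsto> Df(x) v\<close> is \<open>C\<^sup>k\<close> for every \<open>v\<close>.
\<close>

primrec C_k :: "nat \<Rightarrow> ('a::euclidean_space \<Rightarrow> 'b::euclidean_space) \<Rightarrow> bool" where
  "C_k 0 f \<longleftrightarrow> continuous_on UNIV f"
| "C_k (Suc k) f \<longleftrightarrow>
     (\<forall>x. f differentiable (at x)) \<and> (\<forall>v. C_k k (\<lambda>x. frechet_derivative f (at x) v))"

definition smooth :: "('a::euclidean_space \<Rightarrow> 'b::euclidean_space) \<Rightarrow> bool" where
  "smooth f \<longleftrightarrow> (\<forall>k. C_k k f)"

definition diffeomorphism :: "('a::euclidean_space \<Rightarrow> 'b::euclidean_space) \<Rightarrow> bool" where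
  "diffeomorphism H \<longleftrightarrow> bij H \<and> smooth H \<and> smooth (inv H)"

definition smoothly_conjugate ::
    "('a::euclidean_space \<Rightarrow> 'a) \<Rightarrow> ('b::euclidean_space \<Rightarrow> 'b) \<Rightarrow> bool" where
  "smoothly_conjugate F G \<longleftrightarrow>
     diffeomorphism F \<and> diffeomorphism G \<and>
     (\<exists>H :: 'a \<Rightarrow> 'b. diffeomorphism H \<and> H \<circ> F \<circ> inv H = G)"

definition affine_map :: "real^'n^'n \<Rightarrow> real^'n \<Rightarrow> real^'n \<Rightarrow> real^'n" where
  "affine_map A v x = A *v x + v"

end

theory Submission
  imports Defs
begin

text \<open>
  Since \<open>v\<close> is not in the image of \<open>I - A\<close>, some linear functional \<open>w\<close> is invariant under \<open>A\<close> and has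
  \<open>w v = 1\<close>; thus \<open>f(x) = A x + v\<close> raises \<open>w\<close> by \<open>1\<close> and the slab \<open>0 \<le> w \<le> 1\<close> is a fundamental domain.
  Two such maps \<open>F\<close>, \<open>G\<close> are conjugate as soon as some diffeomorphism \<open>h\<close> preserving \<open>w\<close> satisfies
  \<open>h F = G h\<close> near \<open>w = 0\<close>: the maps \<open>G\<^sup>n h F\<^sup>-\<^sup>n\<close> on \<open>n \<le> w \<le> n + 1\<close> fit together smoothly. For
  \<open>G(x) = B x + v\<close> one takes \<open>h\<close> equal to the identity for small \<open>w\<close> and to \<open>G F\<^sup>-\<^sup>1\<close> for \<open>w\<close> near
  \<open>1\<close>, which is possible if \<open>B A\<^sup>-\<^sup>1\<close> is smoothly isotopic to the identity through linear maps
  preserving \<open>w\<close>. A matrix of positive determinant preserving \<open>w\<close> is a product of such matrices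
  \<open>I + a \<phi>\<^sup>T\<close> with \<open>w a = 0\<close> and \<open>1 + \<phi> a > 0\<close>, and each factor has the isotopy
  \<open>I + s a \<phi>\<^sup>T\<close>. So \<open>B\<close> may be the identity or a reflection fixing \<open>v\<close>, and a linear change of
  coordinates gives the normal forms.
\<close>

section \<open>Calculus of smooth maps\<close>

lemma C_k_SucI:
  assumes "\<And>x. (f has_derivative f' x) (at x)" and "\<And>v. C_k k (\<lambda>x. f' x v)"
  shows "C_k (Suc k) f"
proof -
  have "frechet_derivative f (at x) = f' x" for x
    using frechet_derivative_at[OF assms(1)] by simp
  then show ?thesis using assms by (auto simp: differentiable_def)
qed

lemma C_k_Suc_has_derivative:
  assumes "C_k (Suc k) f"
  shows "(f has_derivative frechet_derivative f (at x)) (at x)"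
  using assms by (simp add: frechet_derivative_works)

lemma C_k_Suc_imp: "C_k (Suc k) f \<Longrightarrow> C_k k f"
proof (induction k arbitrary: f)
  case 0
  then show ?case
    by (auto intro!: differentiable_imp_continuous_on differentiable_at_imp_differentiable_on)
next
  case (Suc k)
  then show ?case by (metis C_k.simps(2))
qed

text \<open>\<open>C_k\<close> speaks of the whole space only, so local regularity is expressed by
  agreement near each point with a globally \<open>C_k\<close> function. This makes glued maps
  smooth.\<close>

lemma C_k_local:
  assumes "\<And>x. \<exists>g S. C_k k g \<and> open S \<and> x \<in> S \<and> (\<forall>y\<in>S. f y = g y)"
  shows "C_k k f"
  using assms
proof (induction k arbitrary: f)
  case 0
  have "isCont f x" for x
  proof -
    obtain g S where g: "continuous_on UNIV g" "open S" "x \<in> S" "\<forall>y\<in>S. f y = g y"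
      using 0[of x] by auto
    then have "continuous_on S f"
      by (metis continuous_on_cong continuous_on_subset subset_UNIV)
    then show ?thesis using g continuous_on_eq_continuous_at by blast
  qed
  then show ?case by (simp add: continuous_on_eq_continuous_at)
next
  case (Suc k)
  have *: "(f has_derivative frechet_derivative g (at y)) (at y)"
    if "C_k (Suc k) g" "open S" "\<forall>y\<in>S. f y = g y" "y \<in> S" for g S y
    using has_derivative_transform_within_open[OF C_k_Suc_has_derivative[OF that(1)] that(2,4)] that(3)
    by auto
  have "f differentiable (at x)" for x
    using Suc.prems[of x] * unfolding differentiable_def by metis
  moreover have "C_k k (\<lambda>x. frechet_derivative f (at x) v)" for v
  proof (rule Suc.IH)
    fix x
    obtain g S where g: "C_k (Suc k) g" "open S" "x \<in> S" "\<forall>y\<in>S. f y = g y"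
      using Suc.prems[of x] by auto
    then have "frechet_derivative f (at y) v = frechet_derivative g (at y) v" if "y \<in> S" for y
      using frechet_derivative_at[OF *[OF g(1,2,4) that]] by simp
    then show "\<exists>g S. C_k k g \<and> open S \<and> x \<in> S \<and> (\<forall>y\<in>S. frechet_derivative f (at y) v = g y)"
      using g by (metis C_k.simps(2))
  qed
  ultimately show ?case by simp
qed

lemma C_k_const: "C_k k (\<lambda>x. c)"
proof (induction k arbitrary: c)
  case (Suc k)
  show ?case by (rule C_k_SucI[of _ "\<lambda>x v. 0"]) (auto intro: Suc)
qed auto

lemma C_k_bounded_linear:
  assumes "bounded_linear f"
  shows "C_k k f"
proof (cases k)
  case 0
  then show ?thesis using assms by (simp add: linear_continuous_on)
next
  case (Suc j)
  show ?thesis unfolding Suc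
    by (rule C_k_SucI[of _ "\<lambda>x. f"]) (auto intro: bounded_linear_imp_has_derivative assms C_k_const)
qed

lemma C_k_add: "C_k k f \<Longrightarrow> C_k k g \<Longrightarrow> C_k k (\<lambda>x. f x + g x)"
proof (induction k arbitrary: f g)
  case (Suc k)
  show ?case
    by (rule C_k_SucI[OF has_derivative_add[OF C_k_Suc_has_derivative[OF Suc.prems(1)]
          C_k_Suc_has_derivative[OF Suc.prems(2)]]])
      (use Suc in auto)
qed (auto intro: continuous_intros)

lemma C_k_sum: "(\<And>i. i \<in> I \<Longrightarrow> C_k k (f i)) \<Longrightarrow> C_k k (\<lambda>x. \<Sum>i\<in>I. f i x)"
  by (induction I rule: infinite_finite_induct) (auto intro: C_k_const C_k_add)

lemma C_k_scaleR: "C_k k f \<Longrightarrow> C_k k g \<Longrightarrow> C_k k (\<lambda>x. f x *\<^sub>R g x)"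
proof (induction k arbitrary: f g)
  case (Suc k)
  show ?case
    by (rule C_k_SucI[OF has_derivative_scaleR[OF C_k_Suc_has_derivative[OF Suc.prems(1)]
          C_k_Suc_has_derivative[OF Suc.prems(2)]]], rule C_k_add; rule Suc.IH)
      (use Suc.prems C_k_Suc_imp in auto)
qed (auto intro: continuous_intros)

lemma C_k_inner_const: "C_k k f \<Longrightarrow> C_k k (\<lambda>x. f x \<bullet> c)"
proof (induction k arbitrary: f)
  case (Suc k)
  show ?case
    by (rule C_k_SucI[OF has_derivative_inner_left[OF C_k_Suc_has_derivative[OF Suc.prems]]])
      (use Suc in auto)
qed (auto intro: continuous_intros)

lemma C_k_compose: "C_k k g \<Longrightarrow> C_k k f \<Longrightarrow> C_k k (\<lambda>x. g (f x))"
proof (induction k arbitrary: f g)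
  case 0
  then show ?case using continuous_on_compose2[of UNIV g UNIV f] by auto
next
  case (Suc k)
  let ?g = "\<lambda>x. frechet_derivative g (at x)" and ?f = "\<lambda>x. frechet_derivative f (at x)"
  show ?case
  proof (rule C_k_SucI)
    fix x
    show "((\<lambda>x. g (f x)) has_derivative (\<lambda>v. ?g (f x) (?f x v))) (at x)"
      by (rule has_derivative_compose) (rule C_k_Suc_has_derivative, fact Suc.prems)+
  next
    fix v
    \<comment> \<open>The direction \<open>?f x v\<close> moves with \<open>x\<close>, while
      \<open>C_k\<close> controls the derivative of \<open>g\<close> in fixed directions only;
      expanding over \<open>Basis\<close> reduces to those.\<close>
    have "?g (f x) (?f x v) = (\<Sum>b\<in>Basis. (?f x v \<bullet> b) *\<^sub>R ?g (f x) b)" for x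
    proof -
      have lin: "linear (?g (f x))"
        using C_k_Suc_has_derivative[OF Suc.prems(1)] has_derivative_linear by blast
      have "?g (f x) (?f x v) = ?g (f x) (\<Sum>b\<in>Basis. (?f x v \<bullet> b) *\<^sub>R b)"
        by (simp only: euclidean_representation)
      then show ?thesis by (simp add: linear_sum[OF lin] linear_scale[OF lin])
    qed
    moreover have "C_k k (\<lambda>x. \<Sum>b\<in>Basis. (?f x v \<bullet> b) *\<^sub>R ?g (f x) b)"
    proof (intro C_k_sum C_k_scaleR C_k_inner_const)
      show "C_k k (\<lambda>x. ?f x v)" using Suc.prems by simp
      show "C_k k (\<lambda>x. ?g (f x) b)" for b
        using Suc.IH[of "\<lambda>y. ?g y b" f] Suc.prems C_k_Suc_imp by auto
    qed
    ultimately show "C_k k (\<lambda>x. ?g (f x) (?f x v))" by simp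
  qed
qed

lemma C_k_inverse:
  fixes f :: "'a::euclidean_space \<Rightarrow> real"
  shows "C_k k f \<Longrightarrow> (\<And>x. f x \<noteq> 0) \<Longrightarrow> C_k k (\<lambda>x. inverse (f x))"
proof (induction k arbitrary: f)
  case (Suc k)
  have inv: "C_k k (\<lambda>x. inverse (f x))"
    using Suc C_k_Suc_imp by blast
  show ?case
  proof (rule C_k_SucI[OF Deriv.has_derivative_inverse[OF Suc.prems(2) C_k_Suc_has_derivative[OF Suc.prems(1)]]])
    fix v
    have "C_k k (\<lambda>x. (-1) *\<^sub>R inverse (f x) *\<^sub>R frechet_derivative f (at x) v *\<^sub>R inverse (f x))"
      using Suc.prems by (intro C_k_scaleR inv C_k_const) simp
    then show "C_k k (\<lambda>x. - (inverse (f x) * frechet_derivative f (at x) v * inverse (f x)))"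
      by (simp add: mult.assoc)
  qed
qed (auto intro!: continuous_intros)

lemma C_k_real_SucI:
  fixes f :: "real \<Rightarrow> real"
  assumes "\<And>x. (f has_real_derivative f' x) (at x)" and "C_k k f'"
  shows "C_k (Suc k) f"
proof (rule C_k_SucI[OF assms(1)[unfolded has_field_derivative_def]])
  show "C_k k (\<lambda>x. f' x * v)" for v
    using C_k_scaleR[OF assms(2) C_k_const[of k v]] by simp
qed

lemma smooth_const: "smooth (\<lambda>x. c)"
  and smooth_bounded_linear: "bounded_linear l \<Longrightarrow> smooth l"
  and smooth_add: "smooth f \<Longrightarrow> smooth g \<Longrightarrow> smooth (\<lambda>x. f x + g x)"
  and smooth_scaleR: "smooth r \<Longrightarrow> smooth g \<Longrightarrow> smooth (\<lambda>x. r x *\<^sub>R g x)"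
  and smooth_compose: "smooth h \<Longrightarrow> smooth f \<Longrightarrow> smooth (\<lambda>x. h (f x))"
  and smooth_inverse: "smooth r \<Longrightarrow> (\<And>x. r x \<noteq> 0) \<Longrightarrow> smooth (\<lambda>x. inverse (r x))"
  by (simp_all add: smooth_def C_k_const C_k_bounded_linear C_k_add C_k_scaleR C_k_compose C_k_inverse)

lemma smooth_local:
  assumes "\<And>x. \<exists>g S. smooth g \<and> open S \<and> x \<in> S \<and> (\<forall>y\<in>S. f y = g y)"
  shows "smooth f"
  unfolding smooth_def using assms C_k_local[of _ f] by (metis smooth_def)

section \<open>A smooth step function\<close>

text \<open>The case \<open>m = 0\<close> is the classical flat function exp(-1/x). The powers of
  1/x are included because its derivatives are linear combinations of members of this
  family.\<close>

definition flat :: "nat \<Rightarrow> real \<Rightarrow> real" where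
  "flat m x = (if x > 0 then inverse x ^ m * exp (- inverse x) else 0)"

text \<open>From the right, the substitution s = 1/x turns this into s^m / exp s tending to 0 at
  infinity.\<close>

lemma flat_tendsto_0: "(flat m \<longlongrightarrow> 0) (at 0)"
proof -
  have "(flat m \<longlongrightarrow> 0) (at_right 0)"
  proof (rule Lim_transform_eventually)
    show "((\<lambda>x. inverse x ^ m / exp (inverse x)) \<longlongrightarrow> (0::real)) (at_right 0)"
      using filterlim_compose[OF tendsto_power_div_exp_0 filterlim_inverse_at_top_right] .
    show "\<forall>\<^sub>F x in at_right 0. inverse x ^ m / exp (inverse x) = flat m x"
      by (simp add: eventually_at_filter flat_def exp_minus divide_inverse)
  qed
  moreover have "(flat m \<longlongrightarrow> 0) (at_left 0)"
    by (rule Lim_transform_eventually[OF tendsto_const])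
      (simp add: eventually_at_filter flat_def)
  ultimately show ?thesis by (simp add: filterlim_at_split)
qed

lemma flat_has_derivative:
  "(flat m has_real_derivative flat (m + 2) x - real m * flat (m + 1) x) (at x)"
proof -
  consider "x > 0" | "x < 0" | "x = 0" by linarith
  then show ?thesis
  proof cases
    case 1
    \<comment> \<open>For \<open>m = 0\<close> the truncated exponent is harmless, since the factor
      \<open>real m\<close> vanishes.\<close>
    have pow: "real m * inverse x ^ (m - Suc 0) * inverse x = real m * inverse x ^ m"
      by (cases m) auto
    have "((\<lambda>x. inverse x ^ m) has_real_derivative
        real m * (inverse x ^ (m - Suc 0) * - (inverse x * inverse x))) (at x)"
      using DERIV_power[OF DERIV_inverse, of x m] 1 by (simp add: power2_eq_square mult_ac)
    also have "real m * (inverse x ^ (m - Suc 0) * - (inverse x * inverse x)) = - (real m * inverse x ^ m * inverse x)"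
      using pow by (metis mult.assoc mult_minus_right)
    finally have "((\<lambda>x. inverse x ^ m) has_real_derivative - (real m * inverse x ^ m * inverse x)) (at x)" .
    moreover have "((\<lambda>x. exp (- inverse x)) has_real_derivative exp (- inverse x) * (inverse x * inverse x)) (at x)"
      using 1 by (auto intro!: derivative_eq_intros)
    ultimately have "((\<lambda>x. inverse x ^ m * exp (- inverse x)) has_real_derivative
        flat (m + 2) x - real m * flat (m + 1) x) (at x)"
      by (rule DERIV_cong[OF DERIV_mult]) (use 1 in \<open>simp add: flat_def algebra_simps\<close>)
    then show ?thesis
      by (rule has_field_derivative_transform_within_open[of _ _ _ "{0<..}"]) (use 1 in \<open>auto simp: flat_def\<close>)
  next
    case 2
    have "((\<lambda>x. 0) has_real_derivative 0) (at x)" by simp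
    then have "(flat m has_real_derivative 0) (at x)"
      by (rule has_field_derivative_transform_within_open[of _ _ _ "{..<0}"]) (use 2 in \<open>auto simp: flat_def\<close>)
    then show ?thesis using 2 by (simp add: flat_def)
  next
    case 3
    \<comment> \<open>The difference quotient of \<open>flat m\<close> at 0 is
      \<open>flat (Suc m)\<close>, so the derivative there is 0.\<close>
    have "((\<lambda>y. (flat m y - flat m 0) / (y - 0)) \<longlongrightarrow> 0) (at 0)"
      by (rule Lim_transform_eventually[OF flat_tendsto_0[of "Suc m"]])
        (simp add: eventually_at_filter flat_def divide_inverse)
    then show ?thesis using 3 by (simp add: has_field_derivative_iff flat_def)
  qed
qed

lemma C_k_flat: "C_k k (flat m)"
proof (induction k arbitrary: m)
  case 0
  then show ?case
    using DERIV_isCont[OF flat_has_derivative] by (simp add: continuous_on_eq_continuous_at)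
next
  case (Suc k)
  have "C_k k (\<lambda>x. flat (m + 2) x + (- real m) *\<^sub>R flat (m + 1) x)"
    by (intro C_k_add C_k_scaleR C_k_const Suc)
  then show ?case
    by (intro C_k_real_SucI[OF flat_has_derivative]) simp
qed

lemma smooth_step_exists:
  obtains \<rho> :: "real \<Rightarrow> real" where "smooth \<rho>" "\<And>t. 0 \<le> \<rho> t" "\<And>t. \<rho> t \<le> 1"
    "\<And>t. t < 1/3 \<Longrightarrow> \<rho> t = 0" "\<And>t. t > 2/3 \<Longrightarrow> \<rho> t = 1"
proof
  define f where "f = flat 0"
  \<comment> \<open>The quotient f(t - 1/3) / (f(t - 1/3) + f(2/3 - t)); the denominator is positive
    because t > 1/3 or t < 2/3 always holds.\<close>
  let ?\<rho> = "\<lambda>t. f (t + - (1/3)) *\<^sub>R inverse (f (t + - (1/3)) + f (2/3 + (- 1) *\<^sub>R t))"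
  have pos: "f t > 0" if "t > 0" for t using that by (simp add: f_def flat_def)
  have zero: "f t = 0" if "t \<le> 0" for t using that by (simp add: f_def flat_def)
  have nn: "f t \<ge> 0" for t by (simp add: f_def flat_def)
  have "f (t + - (1/3)) + f (2/3 + (- 1) *\<^sub>R t) > 0" for t
    using pos[of "t + - (1/3)"] pos[of "2/3 + (- 1) *\<^sub>R t"] nn[of "t + - (1/3)"] nn[of "2/3 + (- 1) *\<^sub>R t"]
    by (cases "t > 1/3") (auto simp: add_pos_nonneg add_nonneg_pos)
  note sum_pos = this
  have f: "smooth f" by (simp add: smooth_def f_def C_k_flat)
  have id: "smooth (\<lambda>t::real. t)" by (rule smooth_bounded_linear[OF bounded_linear_ident])
  show "smooth ?\<rho>"
    by (intro smooth_scaleR smooth_inverse smooth_add smooth_compose[OF f] smooth_const id)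
      (use sum_pos in \<open>metis less_irrefl\<close>)
  show "0 \<le> ?\<rho> t" for t using sum_pos[of t] nn by simp
  show "?\<rho> t \<le> 1" for t using sum_pos[of t] nn by (simp add: field_simps)
  show "?\<rho> t = 0" if "t < 1/3" for t using zero that by simp
  show "?\<rho> t = 1" if "t > 2/3" for t
    using zero[of "2/3 - t"] pos[of "t - 1/3"] that by simp
qed

section \<open>Rank-one perturbations of the identity\<close>

definition rank_one :: "real^'n \<Rightarrow> real^'n \<Rightarrow> real^'n^'n" where
  "rank_one a \<phi> = (\<chi> i j. a $ i * \<phi> $ j)"

lemma rank_one_mult: "(mat 1 + rank_one a \<phi>) *v x = x + (\<phi> \<bullet> x) *\<^sub>R a"
  by (simp add: rank_one_def matrix_vector_mult_def mat_def vec_eq_iff inner_vec_def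
      distrib_right sum.distrib if_distrib[of "\<lambda>c. c * _"] cong: if_cong)
    (simp add: sum_distrib_left mult_ac)

text \<open>The rows of the identity are perturbed one at a time: \<open>M S\<close> has the
  multiples of \<phi> added in the rows of \<open>S\<close> only, and linearity in row
  \<open>k\<close> contributes \<phi>_k a_k when \<open>k\<close> joins \<open>S\<close>.\<close>

lemma det_mat_1_plus_rank_one:
  fixes a \<phi> :: "real^'n"
  shows "det (mat 1 + rank_one a \<phi>) = 1 + \<phi> \<bullet> a"
proof -
  define M :: "'n set \<Rightarrow> real^'n^'n" where
    "M S = (\<chi> i. if i \<in> S then row i (mat 1) + (a $ i) *s \<phi> else row i (mat 1))" for S
  \<comment> \<open>With \<phi> itself in row \<open>k\<close>, row operations remove the multiples
    of \<phi> from all other rows, leaving the identity with one row replaced.\<close>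
  have phi: "det (\<chi> i. if i = k then \<phi> else M S $ i) = \<phi> $ k" if "k \<notin> S" for k S
    using finite[of S] that
  proof (induction S)
    case empty
    have eq: "(\<Sum>i\<in>UNIV. \<phi> $ i *s row i (mat 1)) = \<phi>"
      by (simp add: vec_eq_iff row_def mat_def sum_component if_distrib cong: if_cong)
    have "det (\<chi> i. if i = k then \<phi> else row i (mat 1)) = \<phi> $ k"
      using cramer_lemma_transpose[where A = "mat 1" and x = \<phi> and k = k]
      by (simp only: eq det_I mult_1_right)
    then show ?case by (simp add: M_def cong: if_cong)
  next
    case (insert j S)
    let ?N = "\<chi> i. if i = k then \<phi> else M S $ i"
    have "(\<chi> i. if i = k then \<phi> else M (insert j S) $ i)
        = (\<chi> i. if i = j then row j ?N + (a $ j) *s row k ?N else row i ?N)"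
      using insert by (auto simp: vec_eq_iff M_def row_def)
    then show ?case using det_row_operation[of j k ?N "a $ j"] insert by auto
  qed
  have "det (M S) = 1 + (\<Sum>i\<in>S. \<phi> $ i * a $ i)" for S
    using finite[of S]
  proof (induction S)
    case empty
    have "M {} = mat 1" by (simp add: M_def vec_eq_iff row_def)
    then show ?case by simp
  next
    case (insert k S)
    have "M (insert k S) = (\<chi> i. if i = k then M S $ k + (a $ k) *s \<phi> else M S $ i)"
      using insert by (auto simp: vec_eq_iff M_def row_def)
    then have "det (M (insert k S)) = det (\<chi> i. if i = k then M S $ k else M S $ i)
        + a $ k * det (\<chi> i. if i = k then \<phi> else M S $ i)"
      by (simp only: det_row_add det_row_mul)
    moreover have "(\<chi> i. if i = k then M S $ k else M S $ i) = M S"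
      by (simp add: vec_eq_iff)
    ultimately show ?case using insert phi[of k S] by (simp add: mult.commute)
  qed
  moreover have "M UNIV = mat 1 + rank_one a \<phi>"
    by (simp add: M_def rank_one_def vec_eq_iff row_def)
  ultimately show ?thesis by (metis inner_vec_def inner_real_def)
qed

section \<open>Conjugacy by gluing over a fundamental domain\<close>

lemma diffeomorphismI:
  assumes "smooth f" "smooth g" "\<And>x. g (f x) = x" "\<And>y. f (g y) = y"
  shows "diffeomorphism f" and "inv f = g"
proof -
  show "inv f = g" by (rule inv_equality) (use assms in auto)
  with assms show "diffeomorphism f"
    unfolding diffeomorphism_def by (metis bij_betw_byWitness subset_UNIV)
qed

lemma diffeomorphism_inv:
  assumes "diffeomorphism f"
  shows "diffeomorphism (inv f)" "inv f (f x) = x" "f (inv f y) = y" "smooth f" "smooth (inv f)"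
  using assms
  by (auto simp: diffeomorphism_def bij_imp_bij_inv inv_inv_eq bij_is_inj bij_is_surj surj_f_inv_f)

lemma diffeomorphism_compose:
  assumes "diffeomorphism f" "diffeomorphism g"
  shows "diffeomorphism (\<lambda>x. f (g x))"
  by (rule diffeomorphismI(1)[where g = "\<lambda>x. inv g (inv f x)"])
    (use diffeomorphism_inv[OF assms(1)] diffeomorphism_inv[OF assms(2)] in \<open>auto intro: smooth_compose\<close>)

lemma smoothly_conjugateI:
  assumes "diffeomorphism F" "diffeomorphism G" "diffeomorphism H" "\<And>x. H (F x) = G (H x)"
  shows "smoothly_conjugate F G"
  unfolding smoothly_conjugate_def
  using assms diffeomorphism_inv[OF assms(3)] by (auto intro!: exI[of _ H])

lemma smoothly_conjugate_trans:
  assumes "smoothly_conjugate F G" "smoothly_conjugate G K"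
  shows "smoothly_conjugate F K"
proof -
  obtain H where H: "diffeomorphism H" "H \<circ> F \<circ> inv H = G"
    using assms by (auto simp: smoothly_conjugate_def)
  obtain J where J: "diffeomorphism J" "J \<circ> G \<circ> inv J = K"
    using assms by (auto simp: smoothly_conjugate_def)
  have "J (H (F x)) = K (J (H x))" for x
    using fun_cong[OF H(2), of "H x"] fun_cong[OF J(2), of "J (H x)"]
      diffeomorphism_inv[OF H(1)] diffeomorphism_inv[OF J(1)] by simp
  then show ?thesis
    using smoothly_conjugateI[OF _ _ diffeomorphism_compose[OF J(1) H(1)]] assms
    by (simp add: smoothly_conjugate_def)
qed

section \<open>Integer iterates of a bijection\<close>

definition ziter :: "('a \<Rightarrow> 'a) \<Rightarrow> int \<Rightarrow> 'a \<Rightarrow> 'a" where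
  "ziter F n = (if n \<ge> 0 then F ^^ nat n else inv F ^^ nat (- n))"

lemma ziter_Suc:
  assumes "bij F"
  shows "ziter F (n + 1) x = F (ziter F n x)"
proof (cases "n \<ge> 0")
  case True
  then show ?thesis by (simp add: ziter_def nat_add_distrib)
next
  case False
  then have "nat (- n) = Suc (nat (- (n + 1)))" by simp
  then show ?thesis using False assms
    by (auto simp: ziter_def bij_is_surj surj_f_inv_f)
qed

lemma ziter_Suc2:
  assumes "bij F"
  shows "ziter F (n + 1) x = ziter F n (F x)"
proof (cases "n \<ge> 0")
  case True
  then show ?thesis by (simp add: ziter_def nat_add_distrib funpow_swap1)
next
  case False
  then have "nat (- n) = Suc (nat (- (n + 1)))" by simp
  then show ?thesis using False assms
    by (auto simp: ziter_def bij_is_inj funpow_swap1)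
qed

lemma ziter_minus:
  assumes "bij F"
  shows "ziter F n (ziter F (- n) x) = x"
proof (induction n arbitrary: x rule: int_induct[of _ 0])
  case base
  then show ?case by (simp add: ziter_def)
next
  case (step1 i)
  have "F (ziter F (- (i + 1)) x) = ziter F (- i) x"
    using ziter_Suc[OF assms, of "- (i + 1)" x] by simp
  then show ?case using step1 by (simp only: ziter_Suc2[OF assms])
next
  case (step2 i)
  \<comment> \<open>After applying \<open>F\<close> to both sides, the induction hypothesis at
    \<open>F x\<close> gives the downward step; injectivity cancels \<open>F\<close>.\<close>
  have "F (ziter F (i - 1) (ziter F (- (i - 1)) x)) = F x"
    using ziter_Suc[OF assms, of "i - 1"] ziter_Suc2[OF assms, of "- i"] step2(2)[of "F x"]
    by (simp add: algebra_simps)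
  then show ?case using assms by (simp add: bij_is_inj inj_eq)
qed

lemma smooth_ziter:
  assumes "diffeomorphism F"
  shows "smooth (ziter F n)"
proof -
  have "smooth (f ^^ k)" if "smooth f" for k and f :: "'a \<Rightarrow> 'a"
    by (induction k) (auto simp: o_def id_def intro: smooth_compose that smooth_bounded_linear)
  then show ?thesis using diffeomorphism_inv[OF assms] by (simp add: ziter_def)
qed

lemma ziter_shift:
  assumes "bij F" "\<And>x. \<tau> (F x) = \<tau> x + (1::real)"
  shows "\<tau> (ziter F n x) = \<tau> x + n"
proof (induction n rule: int_induct[of _ 0])
  case base
  then show ?case by (simp add: ziter_def)
next
  case (step1 i)
  then show ?case using assms by (simp add: ziter_Suc)
next
  case (step2 i)
  then show ?case using ziter_Suc[OF assms(1), of "i - 1" x] assms(2)[of "ziter F (i - 1) x"] by simp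
qed

text \<open>The floor picks the power of \<open>F\<close> that carries \<open>x\<close> into the
  fundamental domain 0 \<le> \<tau> < 1, where \<open>h\<close> acts before the matching power of
  \<open>G\<close> moves the result back.\<close>

definition glue :: "('a \<Rightarrow> real) \<Rightarrow> ('a \<Rightarrow> 'a) \<Rightarrow> ('a \<Rightarrow> 'a) \<Rightarrow> ('a \<Rightarrow> 'a) \<Rightarrow> 'a \<Rightarrow> 'a" where
  "glue \<tau> F G h x = ziter G \<lfloor>\<tau> x\<rfloor> (h (ziter F (- \<lfloor>\<tau> x\<rfloor>) x))"

lemma smooth_glue:
  assumes F: "diffeomorphism F" and G: "diffeomorphism G" and h: "smooth h"
    and \<tau>: "continuous_on UNIV \<tau>" "\<And>x. \<tau> (F x) = \<tau> x + 1"
    and \<epsilon>: "0 < \<epsilon>" "\<epsilon> \<le> 1" and hFG: "\<And>x. \<bar>\<tau> x\<bar> < \<epsilon> \<Longrightarrow> h (F x) = G (h x)"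
  shows "smooth (glue \<tau> F G h)"
proof (rule smooth_local)
  fix x0
  have bij: "bij F" "bij G" using F G by (auto simp: diffeomorphism_def)
  define n where "n = \<lfloor>\<tau> x0\<rfloor>"
  \<comment> \<open>The slab n \<le> \<tau> < n + 1, widened downwards to be open. As \<epsilon>
    \<le> 1, it meets only the slab of n - 1 besides, and there \<open>hFG\<close> identifies the
    formulas for n - 1 and n.\<close>
  define S where "S = {x. n - \<epsilon> < \<tau> x} \<inter> {x. \<tau> x < n + 1}"
  have "glue \<tau> F G h x = ziter G n (h (ziter F (- n) x))" if "x \<in> S" for x
  proof (cases "\<tau> x \<ge> n")
    case True
    then have "\<lfloor>\<tau> x\<rfloor> = n" using that by (simp add: S_def floor_eq_iff)
    then show ?thesis by (simp add: glue_def)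
  next
    case False
    then have fl: "\<lfloor>\<tau> x\<rfloor> = n - 1" using that \<epsilon> by (simp add: S_def floor_eq_iff)
    let ?y = "ziter F (- n) x"
    have "\<tau> ?y = \<tau> x - n" using ziter_shift[where \<tau> = \<tau>, OF bij(1) \<tau>(2), of "- n"] by simp
    then have "h (F ?y) = G (h ?y)" using False that by (intro hFG) (simp add: S_def)
    moreover have "F ?y = ziter F (- (n - 1)) x"
      using ziter_Suc[OF bij(1), of "- n" x] by simp
    moreover have "ziter G n (h ?y) = ziter G (n - 1) (G (h ?y))"
      using ziter_Suc2[OF bij(2), of "n - 1"] by simp
    ultimately show ?thesis by (simp add: glue_def fl)
  qed
  moreover have "open S" unfolding S_def
    by (intro open_Int open_Collect_less \<tau>(1) continuous_on_const)
  moreover have "x0 \<in> S" using \<epsilon> by (simp add: S_def n_def) linarith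
  moreover have "smooth (\<lambda>x. ziter G n (h (ziter F (- n) x)))"
    by (intro smooth_compose[OF smooth_ziter[OF G]] smooth_compose[OF h] smooth_ziter[OF F])
  ultimately show "\<exists>g S. smooth g \<and> open S \<and> x0 \<in> S \<and> (\<forall>y\<in>S. glue \<tau> F G h y = g y)" by blast
qed

text \<open>The inner glued map preserves \<tau>, so both maps use the same integer and all iterates
  cancel.\<close>

lemma glue_glue:
  assumes F: "bij F" and G: "bij G"
    and \<tau>: "\<And>x. \<tau> (F x) = \<tau> x + 1" "\<And>x. \<tau> (G x) = \<tau> x + 1" "\<And>x. \<tau> (h x) = \<tau> x"
    and k: "\<And>x. k (h x) = x"
  shows "glue \<tau> G F k (glue \<tau> F G h x) = x"
proof -
  have "\<tau> (glue \<tau> F G h x) = \<tau> x"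
    using ziter_shift[where \<tau> = \<tau>, OF F \<tau>(1)] ziter_shift[where \<tau> = \<tau>, OF G \<tau>(2)] \<tau>(3) by (simp add: glue_def)
  then show ?thesis
    using ziter_minus[OF F] ziter_minus[OF G, of "- \<lfloor>\<tau> x\<rfloor>"] k by (simp add: glue_def[of _ G] glue_def[of _ F])
qed

lemma smoothly_conjugate_glue:
  fixes F G h :: "'a::euclidean_space \<Rightarrow> 'a" and \<tau> :: "'a \<Rightarrow> real"
  assumes F: "diffeomorphism F" and G: "diffeomorphism G" and h: "diffeomorphism h"
    and \<tau>: "continuous_on UNIV \<tau>" "\<And>x. \<tau> (F x) = \<tau> x + 1" "\<And>x. \<tau> (G x) = \<tau> x + 1" "\<And>x. \<tau> (h x) = \<tau> x"
    and \<epsilon>: "0 < \<epsilon>" "\<epsilon> \<le> 1" and hFG: "\<And>x. \<bar>\<tau> x\<bar> < \<epsilon> \<Longrightarrow> h (F x) = G (h x)"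
  shows "smoothly_conjugate F G"
proof (rule smoothly_conjugateI[OF F G])
  have bij: "bij F" "bij G" using F G by (auto simp: diffeomorphism_def)
  note hi = diffeomorphism_inv[OF h]
  have \<tau>i: "\<tau> (inv h x) = \<tau> x" for x using \<tau>(4)[of "inv h x"] hi by simp
  have hGF: "inv h (G x) = F (inv h x)" if "\<bar>\<tau> x\<bar> < \<epsilon>" for x
  proof -
    have "h (F (inv h x)) = G x" using hFG[of "inv h x"] that \<tau>i hi(3) by simp
    then show ?thesis using hi(2)[of "F (inv h x)"] by simp
  qed
  show "diffeomorphism (glue \<tau> F G h)"
  proof (rule diffeomorphismI(1)[of _ "glue \<tau> G F (inv h)"])
    show "smooth (glue \<tau> F G h)" by (rule smooth_glue[OF F G hi(4) \<tau>(1,2) \<epsilon> hFG])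
    show "smooth (glue \<tau> G F (inv h))" by (rule smooth_glue[OF G F hi(5) \<tau>(1,3) \<epsilon> hGF])
    show "glue \<tau> G F (inv h) (glue \<tau> F G h x) = x" for x
      by (rule glue_glue[OF bij \<tau>(2-4) hi(2)])
    show "glue \<tau> F G h (glue \<tau> G F (inv h) x) = x" for x
      by (rule glue_glue[OF bij(2,1) \<tau>(3,2) \<tau>i hi(3)])
  qed
  \<comment> \<open>\<open>F\<close> raises the floor by 1: the extra inverse of \<open>F\<close>
    absorbs \<open>F\<close>, and the extra \<open>G\<close> comes out in front.\<close>
  show "glue \<tau> F G h (F x) = G (glue \<tau> F G h x)" for x
    using ziter_Suc[OF bij(2)] ziter_Suc2[OF bij(1), of "- \<lfloor>\<tau> x\<rfloor> - 1" x] by (simp add: glue_def \<tau>(2))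
qed

section \<open>Isotopies preserving a functional\<close>

text \<open>
  The map \<open>h\<close> below is the trace of an isotopy from the identity to \<open>P\<close>, with \<open>w \<bullet> x\<close> as time and with each
  slice taken about the base point \<open>u\<close>, where \<open>w \<bullet> u = 1\<close> in the application.
\<close>

definition isotopic_to_id :: "'a::euclidean_space \<Rightarrow> 'a \<Rightarrow> ('a \<Rightarrow> 'a) \<Rightarrow> bool" where
  "isotopic_to_id w u P \<longleftrightarrow> (\<exists>h. diffeomorphism h \<and> (\<forall>x. w \<bullet> h x = w \<bullet> x) \<and>
     (\<forall>x. w \<bullet> x < 1/3 \<longrightarrow> h x = x) \<and> (\<forall>x. w \<bullet> x > 2/3 \<longrightarrow> h x = P (x - u) + u))"

text \<open>The inner map preserves \<open>w\<close>, so it stays in the region where the outer one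
  is explicit, and the common base point \<open>u\<close> cancels between the two.\<close>

lemma isotopic_to_id_compose:
  assumes "isotopic_to_id w u P" "isotopic_to_id w u Q"
  shows "isotopic_to_id w u (\<lambda>x. P (Q x))"
proof -
  obtain h where h: "diffeomorphism h" "\<And>x. w \<bullet> h x = w \<bullet> x" "\<And>x. w \<bullet> x < 1/3 \<Longrightarrow> h x = x"
    "\<And>x. w \<bullet> x > 2/3 \<Longrightarrow> h x = P (x - u) + u"
    using assms(1) unfolding isotopic_to_id_def by blast
  obtain k where k: "diffeomorphism k" "\<And>x. w \<bullet> k x = w \<bullet> x" "\<And>x. w \<bullet> x < 1/3 \<Longrightarrow> k x = x"
    "\<And>x. w \<bullet> x > 2/3 \<Longrightarrow> k x = Q (x - u) + u"
    using assms(2) unfolding isotopic_to_id_def by blast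
  have "h (k x) = P (Q (x - u)) + u" if "w \<bullet> x > 2/3" for x
    using h(4)[of "k x"] k(2)[of x] k(4)[OF that] that by simp
  then show ?thesis
    unfolding isotopic_to_id_def using diffeomorphism_compose[OF h(1) k(1)] h(2,3) k(2,3)
    by (intro exI[of _ "\<lambda>x. h (k x)"]) auto
qed

lemma isotopic_to_id_ident: "isotopic_to_id w u (\<lambda>x::'a::euclidean_space. x)"
proof -
  have "smooth (\<lambda>x::'a. x)" by (rule smooth_bounded_linear[OF bounded_linear_ident])
  then have "diffeomorphism (\<lambda>x::'a. x)" using diffeomorphismI(1)[of "\<lambda>x::'a. x" "\<lambda>x. x"] by simp
  then show ?thesis unfolding isotopic_to_id_def by (intro exI[of _ "\<lambda>x. x"]) auto
qed

text \<open>Let the coefficient of \<open>a\<close> grow from 0 to 1 through \<rho>(w x). As w a =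
  0, each slice of constant \<open>w\<close> is preserved and can be inverted by itself with the
  rank-one inverse formula; its denominator 1 + \<rho> \<phi> a lies between 1 and 1 + \<phi> a,
  hence is positive.\<close>

lemma isotopic_to_id_rank_one:
  assumes wa: "w \<bullet> a = 0" and \<phi>a: "\<phi> \<bullet> a > - 1"
  shows "isotopic_to_id w u (\<lambda>x. x + (\<phi> \<bullet> x) *\<^sub>R a)"
proof -
  obtain \<rho> :: "real \<Rightarrow> real" where \<rho>: "smooth \<rho>" "\<And>t. 0 \<le> \<rho> t" "\<And>t. \<rho> t \<le> 1"
    "\<And>t. t < 1/3 \<Longrightarrow> \<rho> t = 0" "\<And>t. t > 2/3 \<Longrightarrow> \<rho> t = 1"
    using smooth_step_exists by blast
  have den: "1 + \<rho> t * (\<phi> \<bullet> a) > 0" for t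
  proof (cases "\<phi> \<bullet> a \<ge> 0")
    case True
    then show ?thesis using \<rho>(2)[of t] by (simp add: add_pos_nonneg)
  next
    case False
    then have "\<rho> t * (- (\<phi> \<bullet> a)) \<le> - (\<phi> \<bullet> a)" using \<rho>(3)[of t] by (intro mult_left_le_one_le) (use \<rho> in auto)
    then show ?thesis using \<phi>a by simp
  qed
  have id: "smooth (\<lambda>x::'a. x)" by (rule smooth_bounded_linear[OF bounded_linear_ident])
  have sw: "smooth (\<lambda>x. \<rho> (w \<bullet> x))"
    by (intro smooth_compose[OF \<rho>(1)] smooth_bounded_linear bounded_linear_inner_right)
  have s\<phi>: "smooth (\<lambda>x. \<phi> \<bullet> x + - (\<phi> \<bullet> u))"
    by (intro smooth_add smooth_const smooth_bounded_linear bounded_linear_inner_right)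
  define h where "h = (\<lambda>x. x + (\<rho> (w \<bullet> x) *\<^sub>R (\<phi> \<bullet> x + - (\<phi> \<bullet> u))) *\<^sub>R a)"
  define k where "k = (\<lambda>x. x + ((\<rho> (w \<bullet> x) *\<^sub>R (\<phi> \<bullet> x + - (\<phi> \<bullet> u))) *\<^sub>R
      inverse (1 + \<rho> (w \<bullet> x) *\<^sub>R (\<phi> \<bullet> a))) *\<^sub>R (- a))"
  have wh: "w \<bullet> h x = w \<bullet> x" and wk: "w \<bullet> k x = w \<bullet> x" for x
    by (simp_all add: h_def k_def inner_add_right inner_diff_right wa)
  have "diffeomorphism h"
  proof (rule diffeomorphismI(1)[of _ k])
    show "smooth h" unfolding h_def by (intro smooth_add smooth_scaleR sw s\<phi> id smooth_const)
    show "smooth k" unfolding k_def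
      by (intro smooth_add smooth_scaleR smooth_inverse sw s\<phi> id smooth_const)
        (use den in \<open>metis less_irrefl real_scaleR_def\<close>)
    fix x
    have nz: "1 + \<rho> (w \<bullet> x) * (\<phi> \<bullet> a) \<noteq> 0" using den[of "w \<bullet> x"] by simp
    have "\<phi> \<bullet> h x + - (\<phi> \<bullet> u) = (\<phi> \<bullet> x - \<phi> \<bullet> u) * (1 + \<rho> (w \<bullet> x) * (\<phi> \<bullet> a))"
      by (simp add: h_def inner_add_right algebra_simps)
    then have "k (h x) = h x - (\<rho> (w \<bullet> x) * (\<phi> \<bullet> x - \<phi> \<bullet> u)) *\<^sub>R a"
      unfolding k_def wh using nz by simp
    then show "k (h x) = x" by (simp add: h_def)
    have "\<phi> \<bullet> k x + - (\<phi> \<bullet> u) = (\<phi> \<bullet> x - \<phi> \<bullet> u) * inverse (1 + \<rho> (w \<bullet> x) * (\<phi> \<bullet> a))"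
      using nz by (simp add: k_def inner_diff_right field_simps)
    then have "h (k x) = k x + (\<rho> (w \<bullet> x) * (\<phi> \<bullet> x - \<phi> \<bullet> u) * inverse (1 + \<rho> (w \<bullet> x) * (\<phi> \<bullet> a))) *\<^sub>R a"
      unfolding h_def wk by simp
    then show "h (k x) = x" by (simp add: k_def)
  qed
  moreover have "h x = x" if "w \<bullet> x < 1/3" for x using that by (simp add: h_def \<rho>)
  moreover have "h x = x - u + (\<phi> \<bullet> (x - u)) *\<^sub>R a + u" if "w \<bullet> x > 2/3" for x
    using that by (simp add: h_def \<rho> inner_diff_right)
  ultimately show ?thesis unfolding isotopic_to_id_def using wh by (intro exI[of _ h]) auto
qed

lemma isotopic_to_id_rank_one_cancel:
  fixes P :: "real^'n^'n"
  assumes "isotopic_to_id w u ((*v) ((mat 1 + rank_one a \<phi>) ** P))" and "w \<bullet> a = 0" and "\<phi> \<bullet> a > - 1"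
  shows "isotopic_to_id w u ((*v) P)"
proof -
  \<comment> \<open>Chosen so that I + b \<phi>^T is the inverse of I + a \<phi>^T; moreover 1 +
    \<phi> b = 1 / (1 + \<phi> a) > 0.\<close>
  define b where "b = - inverse (1 + \<phi> \<bullet> a) *\<^sub>R a"
  have "\<phi> \<bullet> b > - 1" using assms(3) by (simp add: b_def field_simps)
  then have inv: "isotopic_to_id w u (\<lambda>x. x + (\<phi> \<bullet> x) *\<^sub>R b)"
    using assms(2) by (intro isotopic_to_id_rank_one) (simp_all add: b_def)
  have "(let y = ((mat 1 + rank_one a \<phi>) ** P) *v x in y + (\<phi> \<bullet> y) *\<^sub>R b) = P *v x" for x
  proof -
    have "\<phi> \<bullet> (P *v x + (\<phi> \<bullet> (P *v x)) *\<^sub>R a) = (\<phi> \<bullet> (P *v x)) * (1 + \<phi> \<bullet> a)"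
      by (simp add: inner_add_right algebra_simps)
    then show ?thesis using assms(3)
      by (simp add: Let_def rank_one_mult b_def flip: matrix_vector_mul_assoc)
  qed
  then show ?thesis using isotopic_to_id_compose[OF inv assms(1)] by (simp add: Let_def)
qed

text \<open>If P x and z lie strictly on the same side of the hyperplane \<phi> = 0, which contains
  \<open>U\<close>, the factor I + a \<psi>^T with a = z - P x and \<psi>(P x) = 1 sends P x to z
  and fixes \<open>U\<close>. Its determinant is \<psi> z > 0.\<close>

lemma rank_one_move:
  fixes P :: "real^'n^'n"
  assumes det: "det P > 0" and w: "\<forall>y. w \<bullet> (P *v y) = w \<bullet> y"
    and U: "\<forall>y\<in>U. P *v y = y" "\<forall>y\<in>U. \<phi> \<bullet> y = 0"
    and \<phi>: "\<phi> \<bullet> (P *v x) > 0" "\<phi> \<bullet> z > 0" and wz: "w \<bullet> z = w \<bullet> x"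
  shows "\<exists>Q. det Q > 0 \<and> (\<forall>y. w \<bullet> (Q *v y) = w \<bullet> y) \<and> (\<forall>y\<in>U. Q *v y = y) \<and> Q *v x = z \<and>
    (isotopic_to_id w u ((*v) Q) \<longrightarrow> isotopic_to_id w u ((*v) P))"
proof -
  define a where "a = z - P *v x"
  define \<psi> where "\<psi> = inverse (\<phi> \<bullet> (P *v x)) *\<^sub>R \<phi>"
  define Q where "Q = (mat 1 + rank_one a \<psi>) ** P"
  have Q: "Q *v y = P *v y + (\<psi> \<bullet> (P *v y)) *\<^sub>R a" for y
    by (simp add: Q_def rank_one_mult flip: matrix_vector_mul_assoc)
  have wa: "w \<bullet> a = 0" by (simp add: a_def inner_diff_right w wz)
  have one: "\<psi> \<bullet> (P *v x) = 1" using \<phi> by (simp add: \<psi>_def)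
  have pos: "\<psi> \<bullet> z > 0" using \<phi> by (simp add: \<psi>_def)
  have \<psi>a: "\<psi> \<bullet> a > - 1" using one pos by (simp add: a_def inner_diff_right)
  show ?thesis
  proof (intro exI[of _ Q] conjI allI ballI impI)
    show "det Q > 0" using det \<psi>a by (simp add: Q_def det_mul det_mat_1_plus_rank_one)
    show "w \<bullet> (Q *v y) = w \<bullet> y" for y by (simp add: Q inner_add_right w wa)
    show "Q *v y = y" if "y \<in> U" for y using U that by (simp add: Q \<psi>_def)
    show "Q *v x = z" by (simp add: Q one a_def)
    show "isotopic_to_id w u ((*v) P)" if "isotopic_to_id w u ((*v) Q)"
      by (rule isotopic_to_id_rank_one_cancel[OF that[unfolded Q_def] wa \<psi>a])
  qed
qed

text \<open>
  Induction on the codimension of the fixed space \<open>U\<close> of \<open>P\<close>: one or two rank-one factors move \<open>P x\<close> back to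
  \<open>x\<close> for some \<open>x \<notin> U\<close> while keeping \<open>U\<close> fixed. This fails only if \<open>U\<close> is a hyperplane and \<open>P\<close> reverses
  its sides, which \<open>det P > 0\<close> excludes.
\<close>

lemma isotopic_to_id_det_pos:
  fixes P :: "real^'n^'n"
  assumes "w \<bullet> u = 1" and "det P > 0" and "\<And>x. w \<bullet> (P *v x) = w \<bullet> x"
  shows "isotopic_to_id w u ((*v) P)"
  using assms(2,3)
proof (induction "CARD('n) - dim {x. P *v x = x}" arbitrary: P rule: less_induct)
  case less
  define U where "U = {x. P *v x = x}"
  note det = less.prems(1)
  have wP: "\<forall>x. w \<bullet> (P *v x) = w \<bullet> x" using less.prems(2) by simp
  have subspace_fix: "subspace {x. Q *v x = x}" for Q :: "real^'n^'n"
    by (auto simp: subspace_def matrix_vector_right_distrib matrix_vector_mult_scaleR)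
  have subU: "subspace U" using subspace_fix by (simp add: U_def)
  have PU: "\<forall>y\<in>U. P *v y = y" by (simp add: U_def)
  have inj: "P *v y = P *v z \<Longrightarrow> y = z" for y z
    using det inj_matrix_vector_mult[of P] invertible_det_nz[of P] by (auto dest: injD)
  \<comment> \<open>Fixing \<open>U\<close> and one vector outside it enlarges the fixed space, so
    the induction hypothesis covers \<open>Q\<close>.\<close>
  have IH: "isotopic_to_id w u ((*v) Q)"
    if Q: "det Q > 0" "\<forall>y. w \<bullet> (Q *v y) = w \<bullet> y" "\<forall>y\<in>U. Q *v y = y" "Q *v x = x" "x \<notin> U" for Q x
  proof (rule less.hyps[OF _ Q(1) Q(2)[rule_format]])
    have "span U \<subset> span {x. Q *v x = x}"
      using Q subU subspace_fix span_eq_iff by blast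
    then have "dim U < dim {x. Q *v x = x}" by (rule dim_psubset)
    moreover have "dim {x. Q *v x = x} \<le> CARD('n)"
      using dim_subset_UNIV[of "{x. Q *v x = x}"] by simp
    ultimately show "CARD('n) - dim {x. Q *v x = x} < CARD('n) - dim {x. P *v x = x}"
      by (simp add: U_def)
  qed
  have orth_decomp: "\<exists>y\<in>U. \<exists>z. (\<forall>f\<in>U. z \<bullet> f = 0) \<and> x = y + z" for x
    using orthogonal_subspace_decomp_exists[of U x] subU
    by (metis orthogonal_def span_eq_iff)
  \<comment> \<open>If \<open>w\<close> vanishes on \<open>U\<close>, then \<open>w\<close> itself
    serves as the separating functional and P u is moved to u. Otherwise some \<open>u0\<close> in
    \<open>U\<close> can correct the \<open>w\<close>-value of a target.\<close>
  consider "U = UNIV" | "U \<noteq> UNIV" "\<forall>y\<in>U. w \<bullet> y = 0"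
    | u0 where "U \<noteq> UNIV" "u0 \<in> U" "w \<bullet> u0 \<noteq> 0" by blast
  then show ?case
  proof cases
    case 1
    then have "(*v) P = (\<lambda>x. x)" using PU by auto
    then show ?thesis using isotopic_to_id_ident by metis
  next
    case 2
    have wu: "w \<bullet> (P *v u) > 0" "w \<bullet> u > 0" by (simp_all add: wP assms(1))
    obtain Q where Q: "det Q > 0" "\<forall>y. w \<bullet> (Q *v y) = w \<bullet> y" "\<forall>y\<in>U. Q *v y = y"
      "Q *v u = u" "isotopic_to_id w u ((*v) Q) \<longrightarrow> isotopic_to_id w u ((*v) P)"
      using rank_one_move[where u = u, OF det wP PU 2(2) wu refl] by blast
    have "u \<notin> U" using 2(2) assms(1) by auto
    then show ?thesis using IH[OF Q(1-4)] Q(5) by blast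
  next
    case 3
    obtain x where x: "x \<noteq> 0" "\<forall>f\<in>U. x \<bullet> f = 0"
      using orth_decomp 3(1) by (metis UNIV_eq_I add.right_neutral)
    have xU: "x \<notin> U" using x by auto
    let ?y = "P *v x"
    have yU: "?y \<notin> U"
    proof
      assume "?y \<in> U"
      then have "?y = x" using inj[of ?y x] PU by simp
      then show False using \<open>?y \<in> U\<close> xU by simp
    qed
    \<comment> \<open>First P x goes to \<open>z1\<close>, which is x + z shifted along
      \<open>u0\<close> to have the same \<open>w\<close>-value as \<open>x\<close>; functionals
      vanishing on \<open>U\<close> do not see this shift. Since x z1 = x x > 0, the functional
      \<open>x\<close> then permits moving \<open>z1\<close> to \<open>x\<close>.\<close>
    have two_moves: ?thesis if z: "z \<noteq> 0" "\<forall>f\<in>U. z \<bullet> f = 0" "z \<bullet> x = 0"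
      and \<phi>: "\<forall>f\<in>U. \<phi> \<bullet> f = 0" "\<phi> \<bullet> ?y > 0" "\<phi> \<bullet> (x + z) > 0" for z \<phi>
    proof -
      define z1 where "z1 = x + z - (w \<bullet> z / (w \<bullet> u0)) *\<^sub>R u0"
      have wz1: "w \<bullet> z1 = w \<bullet> x" using 3 by (simp add: z1_def inner_diff_right inner_add_right)
      have \<phi>z1: "\<phi> \<bullet> z1 > 0" using \<phi>(1) 3(2) \<phi>(3)
        by (simp add: z1_def inner_diff_right)
      obtain Q where Q: "det Q > 0" "\<forall>y. w \<bullet> (Q *v y) = w \<bullet> y" "\<forall>y\<in>U. Q *v y = y"
        "Q *v x = z1" "isotopic_to_id w u ((*v) Q) \<longrightarrow> isotopic_to_id w u ((*v) P)"
        using rank_one_move[where u = u, OF det wP PU \<phi>(1,2) \<phi>z1 wz1] by blast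
      have xQ: "x \<bullet> (Q *v x) > 0" "x \<bullet> x > 0"
        using x 3(2) z(3) by (simp_all add: Q z1_def inner_diff_right inner_add_right inner_commute[of x z])
      obtain R where R: "det R > 0" "\<forall>y. w \<bullet> (R *v y) = w \<bullet> y" "\<forall>y\<in>U. R *v y = y"
        "R *v x = x" "isotopic_to_id w u ((*v) R) \<longrightarrow> isotopic_to_id w u ((*v) Q)"
        using rank_one_move[where u = u, OF Q(1,2,3) x(2) xQ refl] by blast
      show ?thesis using IH[OF R(1-4) xU] R(5) Q(5) by blast
    qed
    \<comment> \<open>Either \<open>x\<close> or some \<open>z\<close> orthogonal to
      \<open>U\<close> and \<open>x\<close> is a suitable functional, or P x is orthogonal to every
      such \<open>z\<close>.\<close>
    consider "x \<bullet> ?y > 0"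
      | z where "\<forall>f\<in>U. z \<bullet> f = 0" "z \<bullet> x = 0" "z \<bullet> ?y > 0"
      | "x \<bullet> ?y \<le> 0" "\<forall>z. (\<forall>f\<in>U. z \<bullet> f = 0) \<longrightarrow> z \<bullet> x = 0 \<longrightarrow> \<not> z \<bullet> ?y > 0"
      by (meson not_le)
    then show ?thesis
    proof cases
      case 1
      have xx: "x \<bullet> x > 0" using x(1) by simp
      obtain R where R: "det R > 0" "\<forall>y. w \<bullet> (R *v y) = w \<bullet> y" "\<forall>y\<in>U. R *v y = y"
        "R *v x = x" "isotopic_to_id w u ((*v) R) \<longrightarrow> isotopic_to_id w u ((*v) P)"
        using rank_one_move[where u = u, OF det wP PU x(2) 1 xx refl] by blast
      show ?thesis using IH[OF R(1-4) xU] R(5) by blast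
    next
      case (2 z)
      then have "z \<noteq> 0" "z \<bullet> (x + z) > 0" by (auto simp: inner_add_right)
      with 2 show ?thesis by (intro two_moves[of z z])
    next
      case 3
      have orth_y: "z \<bullet> ?y = 0" if "\<forall>f\<in>U. z \<bullet> f = 0" "z \<bullet> x = 0" for z
        using 3(2)[rule_format, of z] 3(2)[rule_format, of "- z"] that by force
      \<comment> \<open>Were x orthogonal to P x, the component of P x orthogonal to
        \<open>U\<close> would vanish and P x would lie in \<open>U\<close>.\<close>
      have xyneg: "x \<bullet> ?y < 0"
      proof (rule ccontr)
        assume "\<not> x \<bullet> ?y < 0"
        then have xy: "x \<bullet> ?y = 0" using 3(1) by simp
        obtain f g where fg: "f \<in> U" "\<forall>f\<in>U. g \<bullet> f = 0" "?y = f + g"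
          using orth_decomp by blast
        define c where "c = (g \<bullet> x) / (x \<bullet> x)"
        have "(g - c *\<^sub>R x) \<bullet> ?y = 0"
          by (rule orth_y) (use fg x in \<open>auto simp: inner_diff_left c_def\<close>)
        then have "g \<bullet> (f + g) = 0" using xy fg(3) by (simp add: inner_diff_left)
        then have "g = 0" using fg(1,2) by (simp add: inner_add_right)
        then show False using fg yU by simp
      qed
      show ?thesis
      proof (cases "\<exists>z. z \<noteq> 0 \<and> (\<forall>f\<in>U. z \<bullet> f = 0) \<and> z \<bullet> x = 0")
        case True
        then obtain z where z: "z \<noteq> 0" "\<forall>f\<in>U. z \<bullet> f = 0" "z \<bullet> x = 0" by blast
        have zy: "z \<bullet> ?y = 0" using orth_y z by blast
        \<comment> \<open>The term - x makes \<phi> positive on P x, where \<open>z\<close>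
          vanishes; the coefficient of \<open>z\<close> yields \<phi>(x + z) = 2 x x - x x = x
          x.\<close>
        define \<phi> where "\<phi> = (2 * (x \<bullet> x) / (z \<bullet> z)) *\<^sub>R z - x"
        show ?thesis
        proof (rule two_moves[OF z])
          show "\<forall>f\<in>U. \<phi> \<bullet> f = 0" using z(2) x(2) by (simp add: \<phi>_def inner_diff_left)
          show "\<phi> \<bullet> ?y > 0" using zy xyneg by (simp add: \<phi>_def inner_diff_left)
          have "\<phi> \<bullet> (x + z) = x \<bullet> x"
            using z(1,3) by (simp add: \<phi>_def inner_diff_left inner_add_right inner_commute[of x z])
          then show "\<phi> \<bullet> (x + z) > 0" using x(1) by simp
        qed
      next
        case False
        \<comment> \<open>Now \<open>U\<close> is a hyperplane with normal \<open>x\<close>, so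
          \<open>P\<close> is determined by P x and equals I + (P x - x) \<phi>^T. Its determinant
          is \<phi>(P x) < 0, a contradiction.\<close>
        define \<phi> where "\<phi> = inverse (x \<bullet> x) *\<^sub>R x"
        have "P *v r = (mat 1 + rank_one (?y - x) \<phi>) *v r" for r
        proof -
          obtain f g where fg: "f \<in> U" "\<forall>f\<in>U. g \<bullet> f = 0" "r = f + g"
            using orth_decomp by blast
          define c where "c = (g \<bullet> x) / (x \<bullet> x)"
          have "(g - c *\<^sub>R x) \<bullet> x = 0" "\<forall>f\<in>U. (g - c *\<^sub>R x) \<bullet> f = 0"
            using fg x by (auto simp: inner_diff_left c_def)
          then have g: "g = c *\<^sub>R x" using False by (metis eq_iff_diff_eq_0)
          have "\<phi> \<bullet> r = c"
            using x fg(1) by (simp add: fg(3) g \<phi>_def inner_add_right)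
          then have "(mat 1 + rank_one (?y - x) \<phi>) *v r = f + c *\<^sub>R ?y"
            by (simp add: rank_one_mult scaleR_diff_right) (simp add: fg(3) g)
          moreover have "P *v r = f + c *\<^sub>R ?y"
            by (simp add: fg(3) g bspec[OF PU fg(1)] matrix_vector_right_distrib matrix_vector_mult_scaleR)
          ultimately show ?thesis by simp
        qed
        then have "P = mat 1 + rank_one (?y - x) \<phi>" unfolding matrix_eq by blast
        then have "det P = 1 + \<phi> \<bullet> (?y - x)"
          using det_mat_1_plus_rank_one[of "?y - x" \<phi>] by (rule ssubst)
        also have "\<dots> = (x \<bullet> ?y) / (x \<bullet> x)"
          using x(1) by (simp add: \<phi>_def inner_diff_right field_simps)
        also have "\<dots> < 0" using xyneg x(1) by (simp add: divide_neg_pos)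
        finally show ?thesis using det by simp
      qed
    qed
  qed
qed

section \<open>Affine maps\<close>

lemma diffeomorphism_affine_map:
  assumes "invertible A"
  shows "diffeomorphism (affine_map A v)"
proof -
  obtain Ai where Ai: "A ** Ai = mat 1" "Ai ** A = mat 1"
    using assms by (auto simp: invertible_def)
  have smooth_affine: "smooth (affine_map B c)" for B :: "real^'n^'n" and c
    unfolding affine_map_def
    by (intro smooth_add smooth_const smooth_bounded_linear)
      (simp add: linear_conv_bounded_linear[symmetric])
  have "affine_map Ai (- (Ai *v v)) (affine_map A v x) = x" for x
    by (simp add: affine_map_def matrix_vector_right_distrib matrix_vector_mul_assoc Ai)
  moreover have "affine_map A v (affine_map Ai (- (Ai *v v)) x) = x" for x
    by (simp add: affine_map_def matrix_vector_mul_assoc Ai flip: diff_conv_add_uminus)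
      (simp add: matrix_vector_mult_diff_distrib matrix_vector_mul_assoc Ai)
  ultimately show ?thesis
    using diffeomorphismI(1)[OF smooth_affine smooth_affine] by blast
qed

lemma smoothly_conjugate_affine_maps:
  fixes A B :: "real^'n^'n"
  assumes "w \<bullet> v = 1" and wA: "\<And>x. w \<bullet> (A *v x) = w \<bullet> x" and wB: "\<And>x. w \<bullet> (B *v x) = w \<bullet> x"
    and det: "det A * det B > 0"
  shows "smoothly_conjugate (affine_map A v) (affine_map B v)"
proof -
  have inv: "invertible A" "invertible B"
    using det by (auto simp: invertible_det_nz)
  obtain Ai where Ai: "A ** Ai = mat 1" "Ai ** A = mat 1"
    using inv(1) by (auto simp: invertible_def)
  have AAi: "A *v (Ai *v x) = x" "Ai *v (A *v x) = x" for x
    by (simp_all add: matrix_vector_mul_assoc Ai)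
  \<comment> \<open>For F(x) = A x + v and G(x) = B x + v one has G F^-1 (x) = ?P (x - v) + v, so
    the isotopy is taken about the base point \<open>v\<close>.\<close>
  let ?P = "B ** Ai"
  have "det A * det Ai = 1" using arg_cong[OF Ai(1), of det] by (simp add: det_mul)
  moreover have "(det A * det B) * (det Ai * det Ai) = det B * det Ai * (det A * det Ai)"
    by (simp only: mult_ac)
  ultimately have "det ?P = (det A * det B) * (det Ai * det Ai)" and "det Ai \<noteq> 0"
    by (auto simp: det_mul)
  then have "det ?P > 0"
    using mult_pos_pos[OF det] not_real_square_gt_zero[of "det Ai"] by (simp only:) blast
  moreover have "w \<bullet> (?P *v x) = w \<bullet> x" for x
    using wA[of "Ai *v x"] AAi by (simp add: wB flip: matrix_vector_mul_assoc)
  ultimately have "isotopic_to_id w v ((*v) ?P)"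
    using assms(1) by (intro isotopic_to_id_det_pos)
  then obtain h where h: "diffeomorphism h" "\<And>x. w \<bullet> h x = w \<bullet> x" "\<And>x. w \<bullet> x < 1/3 \<Longrightarrow> h x = x"
    "\<And>x. w \<bullet> x > 2/3 \<Longrightarrow> h x = ?P *v (x - v) + v"
    unfolding isotopic_to_id_def by blast
  have shift: "w \<bullet> affine_map A v x = w \<bullet> x + 1" "w \<bullet> affine_map B v x = w \<bullet> x + 1" for x
    by (simp_all add: affine_map_def inner_add_right wA wB assms(1))
  show ?thesis
  \<comment> \<open>If |w x| < 1/3, then w x < 1/3 and w(F x) > 2/3, the two regions where
    \<open>h\<close> is explicit.\<close>
  proof (rule smoothly_conjugate_glue[where \<tau> = "\<lambda>x. w \<bullet> x" and \<epsilon> = "1/3"])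
    show "diffeomorphism (affine_map A v)" "diffeomorphism (affine_map B v)"
      using inv by (simp_all add: diffeomorphism_affine_map)
    show "h (affine_map A v x) = affine_map B v (h x)" if "\<bar>w \<bullet> x\<bar> < 1/3" for x
    proof -
      have "h (affine_map A v x) = ?P *v (affine_map A v x - v) + v"
        using that by (intro h(4)) (simp add: shift abs_less_iff)
      moreover have "h x = x" using that by (intro h(3)) simp
      moreover have "?P *v (A *v x) = B *v x"
        by (simp add: AAi flip: matrix_vector_mul_assoc)
      ultimately show ?thesis by (simp add: affine_map_def)
    qed
  qed (use h shift in \<open>auto intro: continuous_intros\<close>)
qed

lemma smoothly_conjugate_linear:
  assumes F: "diffeomorphism F" and "linear L" "linear M" and inv: "\<And>x. M (L x) = x" "\<And>y. L (M y) = y"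
    and "\<And>x. L (F x) = G (L x)"
  shows "smoothly_conjugate F G"
proof -
  have L: "diffeomorphism L" and M: "diffeomorphism M"
    using diffeomorphismI(1)[of L M] diffeomorphismI(1)[of M L] inv assms(2,3)
    by (simp_all add: smooth_bounded_linear linear_conv_bounded_linear)
  have "G = (\<lambda>y. L (F (M y)))" using assms(6) inv by (auto simp: fun_eq_iff)
  then have "diffeomorphism G"
    using diffeomorphism_compose[OF L diffeomorphism_compose[OF F M]] by simp
  then show ?thesis by (rule smoothly_conjugateI[OF F _ L assms(6)])
qed

text \<open>A vector orthogonal to the image of I - A is an invariant functional. The component
  \<open>z\<close> of \<open>v\<close> orthogonal to that image is nonzero and satisfies z v = z z,
  so it can be normalized.\<close>

lemma invariant_functional_exists:
  fixes A :: "real^'n^'n"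
  assumes "v \<notin> range (\<lambda>x. (mat 1 - A) *v x)"
  obtains w where "w \<bullet> v = 1" "\<And>x. w \<bullet> (A *v x) = w \<bullet> x"
proof -
  let ?S = "range (\<lambda>x. (mat 1 - A) *v x)"
  have sub: "subspace ?S"
    by (rule linear_subspace_image) (auto simp: subspace_UNIV)
  obtain y z where yz: "y \<in> ?S" "\<And>u. u \<in> ?S \<Longrightarrow> z \<bullet> u = 0" "v = y + z"
    using orthogonal_subspace_decomp_exists[of ?S v] sub
    by (metis orthogonal_def span_eq_iff)
  have "z \<noteq> 0" using assms yz(1,3) by auto
  moreover have "z \<bullet> v = z \<bullet> z" using yz(2)[OF yz(1)] by (simp add: yz(3) inner_add_right)
  ultimately have "(inverse (z \<bullet> z) *\<^sub>R z) \<bullet> v = 1" by simp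
  moreover have "z \<bullet> (A *v x) = z \<bullet> x" for x
    using yz(2)[of "(mat 1 - A) *v x"] by (simp add: matrix_vector_mult_diff_rdistrib inner_diff_right)
  ultimately show ?thesis using that[of "inverse (z \<bullet> z) *\<^sub>R z"] by simp
qed

section \<open>Dual vectors and coordinates on their joint kernel\<close>

lemma dim_orthogonal_span:
  fixes S :: "'a::euclidean_space set"
  shows "dim {x. \<forall>y\<in>S. y \<bullet> x = 0} = DIM('a) - dim S"
proof -
  have "(\<forall>y\<in>S. y \<bullet> x = 0) \<longleftrightarrow> (\<forall>y\<in>span S. orthogonal y x)" for x
    using orthogonal_to_span[of _ S x] by (metis orthogonal_def orthogonal_commute span_base)
  then have "{x. \<forall>y\<in>S. y \<bullet> x = 0} = {x \<in> UNIV. \<forall>y\<in>span S. orthogonal y x}"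
    by simp
  then show ?thesis
    using dim_subspace_orthogonal_to_vectors[of "span S" UNIV] by simp
qed

text \<open>Supplies the reflection I - 2 p q^T, which fixes \<open>v\<close> and preserves
  \<open>w\<close>. Here \<open>q\<close> is a nonzero vector \<open>p\<close> of the kernel of
  \<open>w\<close> with its \<open>v\<close>-component removed, rescaled.\<close>

lemma dual_pair_exists:
  fixes v w :: "'a::euclidean_space"
  assumes "DIM('a) \<ge> 2" and "w \<bullet> v = 1"
  obtains p q where "w \<bullet> p = 0" "q \<bullet> v = 0" "q \<bullet> p = 1" "dim {w, q} = 2"
proof -
  obtain p where p: "p \<noteq> 0" "w \<bullet> p = 0"
    using orthogonal_to_vector_exists[OF assms(1)] by (metis orthogonal_def)
  have v: "v \<noteq> 0" using assms(2) by auto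
  define c where "c = (p \<bullet> v) / (v \<bullet> v)"
  define r where "r = p - c *\<^sub>R v"
  have rv: "r \<bullet> v = 0" using v by (simp add: r_def c_def inner_diff_left)
  have "r \<noteq> 0"
  proof
    assume "r = 0"
    then have "p = c *\<^sub>R v" by (simp add: r_def)
    then show False using p assms(2) by auto
  qed
  moreover have "r \<bullet> p = r \<bullet> r"
    using rv by (simp add: r_def inner_diff_right)
  ultimately have q: "(inverse (r \<bullet> r) *\<^sub>R r) \<bullet> p = 1" (is "?q \<bullet> p = 1") by simp
  have "w \<notin> span {?q}"
  proof
    assume "w \<in> span {?q}"
    then obtain d where "w = d *\<^sub>R ?q" by (auto simp: span_singleton)
    then have "w \<bullet> v = d * (?q \<bullet> v)" by (simp only: inner_scaleR_left)
    then show False using rv assms(2) by simp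
  qed
  moreover have "?q \<noteq> 0" using q by auto
  ultimately have "dim {w, ?q} = 2" by (simp add: dim_insert)
  then show ?thesis using that[OF p(2) _ q] rv by simp
qed

text \<open>Both \<open>w\<close> and \<open>q\<close> annihilate the difference of the two sides,
  and in dimension 2 their joint kernel is trivial.\<close>

lemma dual_basis_representation:
  fixes v w p q :: "'a::euclidean_space"
  assumes "w \<bullet> v = 1" "w \<bullet> p = 0" "q \<bullet> v = 0" "q \<bullet> p = 1" "dim {w, q} = 2" "DIM('a) = 2"
  shows "(w \<bullet> x) *\<^sub>R v + (q \<bullet> x) *\<^sub>R p = x"
proof -
  have "dim {x. \<forall>y\<in>{w, q}. y \<bullet> x = 0} = 0"
    using assms by (simp only: dim_orthogonal_span)
  then have "{x. \<forall>y\<in>{w, q}. y \<bullet> x = 0} \<subseteq> {0}" by (simp only: dim_eq_0)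
  moreover have "x - ((w \<bullet> x) *\<^sub>R v + (q \<bullet> x) *\<^sub>R p) \<in> {x. \<forall>y\<in>{w, q}. y \<bullet> x = 0}"
    using assms by (simp add: inner_diff_right inner_add_right)
  ultimately show ?thesis by auto
qed

lemma linear_iso_subspace_UNIV:
  fixes S :: "'a::euclidean_space set"
  assumes "dim {x. \<forall>y\<in>S. y \<bullet> x = 0} = DIM('b::euclidean_space)"
  shows "\<exists>(f :: 'a \<Rightarrow> 'b) g. linear f \<and> linear g \<and> (\<forall>z. \<forall>y\<in>S. y \<bullet> g z = 0) \<and>
    (\<forall>x. (\<forall>y\<in>S. y \<bullet> x = 0) \<longrightarrow> g (f x) = x) \<and> (\<forall>z. f (g z) = z)"
proof -
  let ?U = "{x. \<forall>y\<in>S. y \<bullet> x = 0}"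
  have "subspace ?U" by (auto simp: subspace_def inner_add_right)
  moreover have "dim ?U = dim (UNIV :: 'b set)" using assms by simp
  ultimately obtain f :: "'a \<Rightarrow> 'b" and g where fg: "linear f" "linear g" "f ` ?U = UNIV" "g ` UNIV = ?U"
    "\<And>x. x \<in> ?U \<Longrightarrow> norm (f x) = norm x" "\<And>z. z \<in> UNIV \<Longrightarrow> norm (g z) = norm z"
    "\<And>x. x \<in> ?U \<Longrightarrow> g (f x) = x" "\<And>z. z \<in> UNIV \<Longrightarrow> f (g z) = z"
    by (rule isometries_subspaces[OF _ subspace_UNIV]) blast
  have "g z \<in> ?U" for z using fg(4) by blast
  then show ?thesis using fg by (intro exI[of _ f] exI[of _ g]) auto
qed

text \<open>For negative determinant, n = 2 has its own clause: index types are nonempty, so the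
  zero-dimensional factor is not of the form \<open>real^'k\<close>.\<close>

theorem proposition3p3:
  fixes A :: "real^'n^'n" and v :: "real^'n"
  assumes "invertible A"
    and "CARD('n) \<ge> 2"
    and "v \<notin> range (\<lambda>x. (mat 1 - A) *v x)"
  shows
    "(det A > 0 \<longrightarrow> CARD('m::finite) = CARD('n) - 1 \<longrightarrow>
        smoothly_conjugate (affine_map A v) (\<lambda>(t::real, z::real^'m). (t + 1, z))) \<and>
     (det A < 0 \<longrightarrow> CARD('n) = 2 \<longrightarrow>
        smoothly_conjugate (affine_map A v) (\<lambda>(t::real, y::real). (t + 1, - y))) \<and>
     (det A < 0 \<longrightarrow> CARD('n) > 2 \<longrightarrow> CARD('k::finite) = CARD('n) - 2 \<longrightarrow>
        smoothly_conjugate (affine_map A v)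
          (\<lambda>(t::real, y::real, z'::real^'k). (t + 1, - y, z')))"
proof -
  obtain w where w: "w \<bullet> v = 1" "\<And>x. w \<bullet> (A *v x) = w \<bullet> x"
    using invariant_functional_exists[OF assms(3)] by blast
  obtain p q where pq: "w \<bullet> p = 0" "q \<bullet> v = 0" "q \<bullet> p = 1" "dim {w, q} = 2"
    using dual_pair_exists[of w v] assms(2) w(1) by auto
  \<comment> \<open>The reflection with B p = - p that fixes the kernel of \<open>q\<close>, hence
    \<open>v\<close>; its determinant is 1 - 2 = - 1.\<close>
  define B :: "real^'n^'n" where "B = mat 1 + rank_one p (- 2 *\<^sub>R q)"
  have B: "B *v x = x - (2 * (q \<bullet> x)) *\<^sub>R p" for x
    by (simp add: B_def rank_one_mult)
  have detB: "det B = - 1"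
    using det_mat_1_plus_rank_one[of p "- 2 *\<^sub>R q"] pq(3) by (simp add: B_def)
  have neg: "smoothly_conjugate (affine_map A v) (affine_map B v)" if "det A < 0"
    by (rule smoothly_conjugate_affine_maps[OF w]) (use that in \<open>simp_all add: B inner_diff_right pq detB\<close>)
  have diffeo: "diffeomorphism (affine_map B v)" "diffeomorphism (affine_map (mat 1) v)"
    by (intro diffeomorphism_affine_map; simp add: invertible_det_nz detB)+
  have "smoothly_conjugate (affine_map A v) (\<lambda>(t::real, z::real^'m). (t + 1, z))"
    if "det A > 0" "CARD('m) = CARD('n) - 1"
  proof (rule smoothly_conjugate_trans)
    show "smoothly_conjugate (affine_map A v) (affine_map (mat 1) v)"
      by (rule smoothly_conjugate_affine_maps[OF w]) (use that in simp_all)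
    have "w \<noteq> 0" using w(1) by auto
    then have "dim {x. \<forall>y\<in>{w}. y \<bullet> x = 0} = DIM(real^'m)"
      using that by (simp only: dim_orthogonal_span) simp
    from linear_iso_subspace_UNIV[OF this]
    obtain f :: "real^'n \<Rightarrow> real^'m" and g where f: "linear f" "linear g" "\<forall>z. w \<bullet> g z = 0"
      "\<forall>x. w \<bullet> x = 0 \<longrightarrow> g (f x) = x" "\<forall>z. f (g z) = z"
      by auto
    note f_simps = linear_add[OF f(1)] linear_add[OF f(2)] linear_scale[OF f(1)] linear_scale[OF f(2)]
      linear_diff[OF f(1)] linear_diff[OF f(2)]
    \<comment> \<open>Coordinates for the splitting of the space into the line of \<open>v\<close>
      and the kernel of \<open>w\<close>.\<close>
    define L where "L = (\<lambda>x. (w \<bullet> x, f (x - (w \<bullet> x) *\<^sub>R v)))"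
    define M where "M = (\<lambda>(t, z). t *\<^sub>R v + g z)"
    show "smoothly_conjugate (affine_map (mat 1) v) (\<lambda>(t::real, z::real^'m). (t + 1, z))"
    proof (rule smoothly_conjugate_linear[OF diffeo(2), of L M])
      show "linear L" "linear M"
        by (auto intro!: linearI simp: L_def M_def f_simps inner_add_right algebra_simps)
      show "M (L x) = x" for x
        using f(4)[rule_format, of "x - (w \<bullet> x) *\<^sub>R v"] w(1) by (simp add: L_def M_def inner_diff_right)
      show "L (M y) = y" for y
        by (cases y) (simp add: L_def M_def inner_add_right w f(3,5))
      show "L (affine_map (mat 1) v x) = (\<lambda>(t, z). (t + 1, z)) (L x)" for x
        by (simp add: affine_map_def L_def inner_add_right w algebra_simps)
    qed
  qed
  moreover have "smoothly_conjugate (affine_map A v) (\<lambda>(t::real, y::real). (t + 1, - y))"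
    if "det A < 0" "CARD('n) = 2"
  proof (rule smoothly_conjugate_trans[OF neg[OF that(1)]])
    define L where "L = (\<lambda>x. (w \<bullet> x, q \<bullet> x))"
    define M where "M = (\<lambda>(t, y). t *\<^sub>R v + y *\<^sub>R p)"
    show "smoothly_conjugate (affine_map B v) (\<lambda>(t::real, y::real). (t + 1, - y))"
    proof (rule smoothly_conjugate_linear[OF diffeo(1), of L M])
      show "linear L" "linear M"
        by (auto intro!: linearI simp: L_def M_def inner_add_right algebra_simps)
      show "M (L x) = x" for x
        using dual_basis_representation[OF w(1) pq] that(2) by (simp add: L_def M_def)
      show "L (M y) = y" for y
        by (cases y) (simp add: L_def M_def inner_add_right w pq)
      show "L (affine_map B v x) = (\<lambda>(t, y). (t + 1, - y)) (L x)" for x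
        by (simp add: affine_map_def B L_def inner_add_right inner_diff_right w pq)
    qed
  qed
  moreover have "smoothly_conjugate (affine_map A v) (\<lambda>(t::real, y::real, z'::real^'k). (t + 1, - y, z'))"
    if "det A < 0" "CARD('k) = CARD('n) - 2"
  proof (rule smoothly_conjugate_trans[OF neg[OF that(1)]])
    have "dim {x. \<forall>y\<in>{w, q}. y \<bullet> x = 0} = DIM(real^'k)"
      using that pq(4) by (simp only: dim_orthogonal_span) simp
    from linear_iso_subspace_UNIV[OF this]
    obtain f :: "real^'n \<Rightarrow> real^'k" and g where f: "linear f" "linear g"
      "\<forall>z. w \<bullet> g z = 0 \<and> q \<bullet> g z = 0"
      "\<forall>x. w \<bullet> x = 0 \<and> q \<bullet> x = 0 \<longrightarrow> g (f x) = x" "\<forall>z. f (g z) = z"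
      by auto
    note f_simps = linear_add[OF f(1)] linear_add[OF f(2)] linear_scale[OF f(1)] linear_scale[OF f(2)]
      linear_diff[OF f(1)] linear_diff[OF f(2)]
    \<comment> \<open>Coordinates for the splitting into the lines of \<open>v\<close> and
      \<open>p\<close> and the joint kernel of \<open>w\<close> and \<open>q\<close>.\<close>
    define L where "L = (\<lambda>x. (w \<bullet> x, q \<bullet> x, f (x - (w \<bullet> x) *\<^sub>R v - (q \<bullet> x) *\<^sub>R p)))"
    define M where "M = (\<lambda>(t, y, z). t *\<^sub>R v + y *\<^sub>R p + g z)"
    show "smoothly_conjugate (affine_map B v) (\<lambda>(t::real, y::real, z'::real^'k). (t + 1, - y, z'))"
    proof (rule smoothly_conjugate_linear[OF diffeo(1), of L M])
      show "linear L" "linear M"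
        by (auto intro!: linearI simp: L_def M_def f_simps inner_add_right algebra_simps)
      show "M (L x) = x" for x
        using f(4)[rule_format, of "x - (w \<bullet> x) *\<^sub>R v - (q \<bullet> x) *\<^sub>R p"] w(1) pq
        by (simp add: L_def M_def inner_diff_right)
      show "L (M y) = y" for y
        by (cases y) (simp add: L_def M_def inner_add_right w pq f(3,5))
      show "L (affine_map B v x) = (\<lambda>(t, y, z'). (t + 1, - y, z')) (L x)" for x
      proof -
        have "w \<bullet> affine_map B v x = w \<bullet> x + 1" "q \<bullet> affine_map B v x = - (q \<bullet> x)"
          by (simp_all add: affine_map_def B inner_add_right inner_diff_right w pq)
        moreover have "affine_map B v x - (w \<bullet> x + 1) *\<^sub>R v - (- (q \<bullet> x)) *\<^sub>R p
            = x - (w \<bullet> x) *\<^sub>R v - (q \<bullet> x) *\<^sub>R p"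
          unfolding affine_map_def B mult_2 scaleR_add_left by simp
        ultimately show ?thesis by (simp only: L_def prod.case)
      qed
    qed
  qed
  ultimately show ?thesis by blast
qed

end
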